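(* Let $n\ge 1$ and $m>0$ be integers, and let $\phi(k)=|\{1\le i\le k:\gcd(i,k)=1\}|$ denote Euler's totient function. Let $X$ be the random variable which counts the number of distinct roots in $\mathbb{Z}_n$ of a monic polynomial in $\mathbb{Z}_n[x]$ of degree $m$ chosen uniformly at random. Then: (a) $\mathrm{E}[X]=1$; (b) if $m=1$ then $\mathrm{Var}[X]=0$; otherwise $$\mathrm{Var}[X]=\sum_{d\mid n,\ d\neq n}\frac{d}{n}\,\phi\!\left(\frac{n}{d}\right)=\sum_{d\mid n}\frac{d-1}{n}\,\phi\!\left(\frac{n}{d}\right),$$ where $d$ ranges over positive divisors of $n$. In particular, if $m>1$ and $n=p^k$ where $p$ is a prime number and $k\ge 1$, then $\mathrm{Var}[X]=k(1-1/p)$.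
   Context: $\mathbb{Z}_n$ denotes the ring of integers modulo $n$. $\mathrm{E}[X]$ and $\mathrm{Var}[X]$ denote the expected value and variance of a random variable $X$. A random monic polynomial of degree $m$ is $x^m+a_{m-1}x^{m-1}+\cdots+a_0$ with the coefficient tuple $(a_0,\dots,a_{m-1})$ uniformly distributed on $\mathbb{Z}_n^m$ (so there are $n^m$ equally likely polynomials). Roots are counted without multiplicity: $X$ is the number of $\alpha\in\mathbb{Z}_n$ at which the polynomial vanishes. *)

theory Defs
  imports
    "HOL-Algebra.IntRing"
    "HOL-Algebra.Polynomials"
    "HOL-Number_Theory.Totient"
    "HOL-Probability.Probability"
begin

text \<open>
  \<open>ZFact (int n)\<close> is the quotient ring \<open>\<Z>/n\<Z>\<close>, a commutative ring for every \<open>n\<close> (for \<open>n = 1\<close> it is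
  the zero ring).  Univariate polynomials are the coefficient lists of \<open>HOL-Algebra.Polynomials\<close>,
  with the leading coefficient first.

  The monic polynomial with coefficients \<open>cs = [a\<^sub>m\<^sub>-\<^sub>1, \<dots>, a\<^sub>0]\<close> is the list \<open>\<one> # cs\<close>.  Over a nonzero
  ring these lists are exactly the library polynomials of degree \<open>m\<close> with leading coefficient \<open>\<one>\<close>
  (lemma \<open>monic_polys_eq\<close>).  Over the zero ring the library's carrier consists of \<open>[]\<close> only, because
  leading zeros are not allowed there.  The definition below does not normalize, so that the
  monic polynomials of degree \<open>m\<close> correspond to coefficient tuples of length \<open>m\<close> in this case too.
\<close>

definition monic_polys :: "('a, 'b) ring_scheme \<Rightarrow> nat \<Rightarrow> 'a list set" where
  "monic_polys R m = {\<one>\<^bsub>R\<^esub> # cs | cs. set cs \<subseteq> carrier R \<and> length cs = m}"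

definition num_roots :: "('a, 'b) ring_scheme \<Rightarrow> 'a list \<Rightarrow> nat" where
  "num_roots R f = card {\<alpha> \<in> carrier R. ring.eval R f \<alpha> = \<zero>\<^bsub>R\<^esub>}"

definition random_monic :: "nat \<Rightarrow> nat \<Rightarrow> int set list pmf" where
  "random_monic n m = pmf_of_set (monic_polys (ZFact (int n)) m)"

lemma monic_polys_eq:
  assumes "ring R" and "\<one>\<^bsub>R\<^esub> \<noteq> \<zero>\<^bsub>R\<^esub>"
  shows "monic_polys R m =
    {f \<in> carrier ((carrier R)[X]\<^bsub>R\<^esub>). f \<noteq> [] \<and> Polynomials.degree f = m \<and> Polynomials.lead_coeff f = \<one>\<^bsub>R\<^esub>}"
    (is "_ = ?S")
proof
  have one: "\<one>\<^bsub>R\<^esub> \<in> carrier R"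
    using assms(1) by (simp add: ring.ring_simprules)
  show "monic_polys R m \<subseteq> ?S"
    using one assms(2)
    by (auto simp: monic_polys_def polynomial_def simp flip: univ_poly_carrier)
  show "?S \<subseteq> monic_polys R m"
  proof
    fix f assume f: "f \<in> ?S"
    then obtain a cs where "f = a # cs" by (cases f) auto
    with f show "f \<in> monic_polys R m"
      by (auto simp: monic_polys_def polynomial_def simp flip: univ_poly_carrier)
  qed
qed

lemma monic_polys_image:
  "monic_polys R m = (#) \<one>\<^bsub>R\<^esub> ` {cs. set cs \<subseteq> carrier R \<and> length cs = m}"
  by (auto simp: monic_polys_def)

lemma finite_monic_polys: "finite (carrier R) \<Longrightarrow> finite (monic_polys R m)"
  by (simp add: monic_polys_image finite_lists_length_eq)

lemma card_monic_polys:
  "finite (carrier R) \<Longrightarrow> card (monic_polys R m) = card (carrier R) ^ m"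
  by (simp add: monic_polys_image card_image card_lists_length_eq)

lemma carrier_ZFact: "carrier (ZFact k) = range (\<lambda>a. {b. [b = a] (mod k)})"
proof -
  have "Idl\<^bsub>\<Z>\<^esub> {k} +>\<^bsub>\<Z>\<^esub> a = {b. [b = a] (mod k)}" for a
  proof -
    have "Idl\<^bsub>\<Z>\<^esub> {k} = range (\<lambda>x. x * k)"
      by (subst int.cgenideal_eq_genideal[symmetric]) (auto simp: cgenideal_def)
    then have "Idl\<^bsub>\<Z>\<^esub> {k} +>\<^bsub>\<Z>\<^esub> a = range (\<lambda>x. x * k + a)"
      by (auto simp: a_r_coset_def r_coset_def)
    also have "\<dots> = {b. [b = a] (mod k)}"
      by (auto simp: cong_iff_dvd_diff image_iff dvd_def algebra_simps)
    finally show ?thesis .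
  qed
  then show ?thesis
    by (auto simp: ZFact_defs A_RCOSETS_def' image_iff)
qed

lemma bij_betw_ZFact:
  assumes "n \<ge> 1"
  shows "bij_betw (\<lambda>a. {b. [b = a] (mod int n)}) {0..<int n} (carrier (ZFact (int n)))"
proof (rule bij_betw_imageI)
  show "inj_on (\<lambda>a. {b. [b = a] (mod int n)}) {0..<int n}"
  proof (rule inj_onI)
    fix x y :: int
    assume xy: "x \<in> {0..<int n}" "y \<in> {0..<int n}"
      and eq: "{b. [b = x] (mod int n)} = {b. [b = y] (mod int n)}"
    have "x \<in> {b. [b = x] (mod int n)}" by simp
    then have "[x = y] (mod int n)" unfolding eq by simp
    with xy show "x = y" by (intro cong_less_imp_eq_int[of x "int n" y]) auto
  qed
  have "{b. [b = a] (mod int n)} \<in> (\<lambda>a. {b. [b = a] (mod int n)}) ` {0..<int n}" for a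
    using assms by (intro image_eqI[of _ _ "a mod int n"]) (auto simp: cong_def)
  then show "(\<lambda>a. {b. [b = a] (mod int n)}) ` {0..<int n} = carrier (ZFact (int n))"
    by (auto simp: carrier_ZFact)
qed

lemma finite_ZFact: "n \<ge> 1 \<Longrightarrow> finite (carrier (ZFact (int n)))"
  using bij_betw_finite[OF bij_betw_ZFact] by simp

lemma card_ZFact: "n \<ge> 1 \<Longrightarrow> card (carrier (ZFact (int n))) = n"
  using bij_betw_same_card[OF bij_betw_ZFact] by simp

lemma set_pmf_random_monic:
  assumes "n \<ge> 1"
  shows "set_pmf (random_monic n m) = monic_polys (ZFact (int n)) m"
proof -
  have "finite (monic_polys (ZFact (int n)) m)"
    by (intro finite_monic_polys finite_ZFact assms)
  moreover have "card (monic_polys (ZFact (int n)) m) = n ^ m"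
    using assms by (simp add: card_monic_polys finite_ZFact card_ZFact)
  then have "monic_polys (ZFact (int n)) m \<noteq> {}"
    using assms by auto
  ultimately show ?thesis
    by (simp add: random_monic_def)
qed

end

theory Submission
  imports Defs
begin

text \<open>
  Both moments are computed by exchanging the order of summation.  Over a finite commutative ring
  \<open>R\<close>, for a fixed \<open>\<alpha>\<close> the other coefficients determine the constant term of a polynomial vanishing
  at \<open>\<alpha>\<close>, so each \<open>\<alpha>\<close> is a root with probability \<open>1/|R|\<close>.  If \<open>f\<close> is to vanish at both \<open>\<alpha>\<close> and \<open>\<beta>\<close>,
  then the linear coefficient \<open>a\<close> satisfies \<open>a(\<alpha> - \<beta>) = h(\<beta>) - h(\<alpha>)\<close>, where \<open>h\<close> collects the
  terms of degree at least two.  As \<open>\<alpha> - \<beta>\<close> divides the right-hand side, the solutions form a coset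
  of the annihilator of \<open>\<alpha> - \<beta>\<close>.  In \<open>\<Z>/n\<Z>\<close> the annihilator of \<open>\<delta>\<close> has \<open>gcd(\<delta>, n)\<close> elements, and
  \<open>\<Sum>\<^sub>\<delta> gcd(\<delta>, n) = \<Sum>\<^bsub>d | n\<^esub> d \<phi>(n/d)\<close>.
\<close>

section \<open>Counting monic polynomials with prescribed roots\<close>

text \<open>Lists start with the leading coefficient, so the last entry is the constant term and
  \<open>f @ [b]\<close> stands for \<open>x * f + b\<close>. Peeling off constant terms in this way
  drives all the counts below.\<close>

lemma monic_polys_Suc:
  "monic_polys R (Suc k) = (\<lambda>(f, b). f @ [b]) ` (monic_polys R k \<times> carrier R)"
proof (intro equalityI subsetI)
  fix f assume "f \<in> monic_polys R (Suc k)"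
  then obtain cs where cs: "f = \<one>\<^bsub>R\<^esub> # cs" "set cs \<subseteq> carrier R" "length cs = Suc k"
    by (auto simp: monic_polys_def)
  then obtain ds b where "cs = ds @ [b]" by (cases cs rule: rev_cases) auto
  with cs show "f \<in> (\<lambda>(f, b). f @ [b]) ` (monic_polys R k \<times> carrier R)"
    by (intro image_eqI[of _ _ "(\<one>\<^bsub>R\<^esub> # ds, b)"]) (auto simp: monic_polys_def)
next
  fix f assume "f \<in> (\<lambda>(f, b). f @ [b]) ` (monic_polys R k \<times> carrier R)"
  then show "f \<in> monic_polys R (Suc k)"
    by (auto simp: monic_polys_def)
qed

lemma (in ring) set_monic_polys: "f \<in> monic_polys R k \<Longrightarrow> set f \<subseteq> carrier R"
  by (auto simp: monic_polys_def)

text \<open>Induction along Horner's scheme. It is used for the terms of degree at least two, to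
  make the equation for the linear coefficient solvable.\<close>

lemma (in cring) eval_diff_divisible:
  assumes "set p \<subseteq> carrier R" "x \<in> carrier R" "y \<in> carrier R"
  shows "\<exists>c\<in>carrier R. eval p x \<ominus> eval p y = c \<otimes> (x \<ominus> y)"
  using assms(1)
proof (induction p rule: rev_induct)
  case Nil
  with assms show ?case by (intro bexI[of _ \<zero>]) (auto simp: r_neg minus_eq)
next
  case (snoc b p)
  then obtain c where c: "c \<in> carrier R" "eval p x \<ominus> eval p y = c \<otimes> (x \<ominus> y)" by auto
  have b: "b \<in> carrier R" and p: "set p \<subseteq> carrier R" using snoc.prems by auto
  note ev = eval_in_carrier[OF p assms(2)] eval_in_carrier[OF p assms(3)]
  have "eval (p @ [b]) x \<ominus> eval (p @ [b]) y
      = eval p x \<otimes> x \<oplus> b \<ominus> (eval p y \<otimes> y \<oplus> b)"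
    using b p assms by (simp add: eval_append_aux)
  \<comment> \<open>Telescoping through the mixed product \<open>eval p y \<otimes> x\<close>; the
    term \<open>b\<close> cancels.\<close>
  also have "\<dots> = (eval p x \<ominus> eval p y) \<otimes> x \<oplus> eval p y \<otimes> (x \<ominus> y)"
    using b assms ev by algebra
  also have "\<dots> = (c \<otimes> x \<oplus> eval p y) \<otimes> (x \<ominus> y)"
    unfolding c(2) using c(1) assms ev by algebra
  finally show ?case using c(1) assms ev by (intro bexI[of _ "c \<otimes> x \<oplus> eval p y"]) auto
qed

text \<open>The root condition fixes the constant term and leaves \<open>g = butlast f\<close> free.
  The predicate \<open>P\<close> lets a second condition on \<open>g\<close> be carried along, which
  is how a second root enters later.\<close>

lemma (in cring) card_filter_monic_polys_root:
  assumes "\<alpha> \<in> carrier R"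
  shows "card {f \<in> monic_polys R (Suc k). eval f \<alpha> = \<zero> \<and> P (butlast f)}
    = card {g \<in> monic_polys R k. P g}"
proof -
  let ?e = "\<lambda>g. g @ [\<ominus> (eval g \<alpha> \<otimes> \<alpha>)]"
  have "{f \<in> monic_polys R (Suc k). eval f \<alpha> = \<zero> \<and> P (butlast f)}
      = ?e ` {g \<in> monic_polys R k. P g}"
  proof (intro equalityI subsetI)
    fix f assume f: "f \<in> {f \<in> monic_polys R (Suc k). eval f \<alpha> = \<zero> \<and> P (butlast f)}"
    then obtain g b where g: "f = g @ [b]" "g \<in> monic_polys R k" "b \<in> carrier R"
      by (auto simp: monic_polys_Suc)
    note gs = set_monic_polys[OF g(2)]
    have ev: "eval g \<alpha> \<in> carrier R" by (rule eval_in_carrier[OF gs assms])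
    have "b \<oplus> eval g \<alpha> \<otimes> \<alpha> = \<zero>"
      using f g gs assms ev by (simp add: eval_append_aux a_comm)
    then have "b = \<ominus> (eval g \<alpha> \<otimes> \<alpha>)"
      using g(3) ev assms by (metis m_closed minus_equality)
    then show "f \<in> ?e ` {g \<in> monic_polys R k. P g}" using f g by auto
  next
    fix f assume "f \<in> ?e ` {g \<in> monic_polys R k. P g}"
    then obtain g where g: "f = ?e g" "g \<in> monic_polys R k" "P g" by auto
    note gs = set_monic_polys[OF g(2)]
    have ev: "eval g \<alpha> \<in> carrier R" by (rule eval_in_carrier[OF gs assms])
    then have "eval f \<alpha> = \<zero>" using g gs assms by (simp add: eval_append_aux r_neg)
    then show "f \<in> {f \<in> monic_polys R (Suc k). eval f \<alpha> = \<zero> \<and> P (butlast f)}"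
      using g ev assms by (auto simp: monic_polys_Suc intro!: image_eqI[of _ _ "(g, _)"])
  qed
  then show ?thesis by (simp add: card_image inj_on_def)
qed

lemma (in cring) card_monic_polys_root:
  assumes "\<alpha> \<in> carrier R"
  shows "card {f \<in> monic_polys R (Suc k). eval f \<alpha> = \<zero>} = card (monic_polys R k)"
  using card_filter_monic_polys_root[OF assms, of k "\<lambda>_. True"] by simp

text \<open>The solution set is the annihilator of \<delta> translated by the particular solution
  \<open>c\<close>.\<close>

lemma (in cring) card_linear_solutions:
  assumes "c \<in> carrier R" "\<delta> \<in> carrier R"
  shows "card {a \<in> carrier R. a \<otimes> \<delta> = c \<otimes> \<delta>} = card {a \<in> carrier R. a \<otimes> \<delta> = \<zero>}"
proof -
  have "bij_betw (\<lambda>a. a \<ominus> c) {a \<in> carrier R. a \<otimes> \<delta> = c \<otimes> \<delta>} {a \<in> carrier R. a \<otimes> \<delta> = \<zero>}"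
  proof (rule bij_betw_byWitness[where f' = "\<lambda>a. a \<oplus> c"])
    show "\<forall>a\<in>{a \<in> carrier R. a \<otimes> \<delta> = c \<otimes> \<delta>}. a \<ominus> c \<oplus> c = a"
    proof safe
      fix a assume "a \<in> carrier R" then show "a \<ominus> c \<oplus> c = a" using assms by algebra
    qed
    show "\<forall>a\<in>{a \<in> carrier R. a \<otimes> \<delta> = \<zero>}. a \<oplus> c \<ominus> c = a"
    proof safe
      fix a assume "a \<in> carrier R" then show "a \<oplus> c \<ominus> c = a" using assms by algebra
    qed
    show "(\<lambda>a. a \<ominus> c) ` {a \<in> carrier R. a \<otimes> \<delta> = c \<otimes> \<delta>} \<subseteq> {a \<in> carrier R. a \<otimes> \<delta> = \<zero>}"
    proof safe
      fix a assume a: "a \<in> carrier R" "a \<otimes> \<delta> = c \<otimes> \<delta>"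
      have "(a \<ominus> c) \<otimes> \<delta> = a \<otimes> \<delta> \<ominus> c \<otimes> \<delta>" using a(1) assms by algebra
      then show "(a \<ominus> c) \<otimes> \<delta> = \<zero>" using a assms by (simp add: minus_eq r_neg)
    qed (use assms in auto)
    show "(\<lambda>a. a \<oplus> c) ` {a \<in> carrier R. a \<otimes> \<delta> = \<zero>} \<subseteq> {a \<in> carrier R. a \<otimes> \<delta> = c \<otimes> \<delta>}"
      using assms by (auto simp: l_distr)
  qed
  then show ?thesis by (rule bij_betw_same_card)
qed

text \<open>The first root determines the constant term, and the second restricts the linear
  coefficient to a coset of an annihilator; the remaining \<open>k\<close> coefficients are free.
  The case \<alpha> = \<beta> is included: the annihilator of \<open>\<zero>\<close> is the whole
  ring.\<close>

lemma (in cring) card_monic_polys_two_roots: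
  assumes \<alpha>: "\<alpha> \<in> carrier R" and \<beta>: "\<beta> \<in> carrier R" and fin: "finite (carrier R)"
  shows "card {f \<in> monic_polys R (Suc (Suc k)). eval f \<alpha> = \<zero> \<and> eval f \<beta> = \<zero>}
    = card (monic_polys R k) * card {a \<in> carrier R. a \<otimes> (\<alpha> \<ominus> \<beta>) = \<zero>}"
proof -
  let ?S = "\<lambda>g. {a \<in> carrier R. eval (g @ [a]) \<alpha> \<otimes> \<alpha> = eval (g @ [a]) \<beta> \<otimes> \<beta>}"
  have "{f \<in> monic_polys R (Suc (Suc k)). eval f \<alpha> = \<zero> \<and> eval f \<beta> = \<zero>}
    = {f \<in> monic_polys R (Suc (Suc k)). eval f \<alpha> = \<zero> \<and>
        eval (butlast f) \<alpha> \<otimes> \<alpha> = eval (butlast f) \<beta> \<otimes> \<beta>}"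
  proof (rule Collect_cong, rule conj_cong[OF refl], rule conj_cong[OF refl])
    fix f assume f: "f \<in> monic_polys R (Suc (Suc k))" and 0: "eval f \<alpha> = \<zero>"
    then obtain g b where g: "f = g @ [b]" "g \<in> monic_polys R (Suc k)" "b \<in> carrier R"
      by (subst (asm) monic_polys_Suc) auto
    note gs = set_monic_polys[OF g(2)]
    note ev = eval_in_carrier[OF gs \<alpha>] eval_in_carrier[OF gs \<beta>]
    \<comment> \<open>Both values of \<open>f\<close> contain the same constant term
      \<open>b\<close>, so it cancels and the second root becomes a condition on
      \<open>butlast f\<close> alone.\<close>
    have "eval g \<alpha> \<otimes> \<alpha> \<oplus> b = \<zero>" using 0 g gs \<alpha> by (simp add: eval_append_aux)
    moreover have "eval f \<beta> = eval g \<beta> \<otimes> \<beta> \<oplus> b" using g gs \<beta> by (simp add: eval_append_aux)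
    ultimately show "eval f \<beta> = \<zero> \<longleftrightarrow> eval (butlast f) \<alpha> \<otimes> \<alpha> = eval (butlast f) \<beta> \<otimes> \<beta>"
      using g ev \<alpha> \<beta> by (metis add.right_cancel butlast_snoc m_closed)
  qed
  then have "card {f \<in> monic_polys R (Suc (Suc k)). eval f \<alpha> = \<zero> \<and> eval f \<beta> = \<zero>}
      = card {h \<in> monic_polys R (Suc k). eval h \<alpha> \<otimes> \<alpha> = eval h \<beta> \<otimes> \<beta>}"
    using card_filter_monic_polys_root[OF \<alpha>, of "Suc k" "\<lambda>h. eval h \<alpha> \<otimes> \<alpha> = eval h \<beta> \<otimes> \<beta>"] by simp
  \<comment> \<open>The last entry \<open>a\<close> of \<open>h\<close> is the linear coefficient of
    the original polynomial; \<open>?S g\<close> collects its admissible values.\<close>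
  also have "{h \<in> monic_polys R (Suc k). eval h \<alpha> \<otimes> \<alpha> = eval h \<beta> \<otimes> \<beta>}
      = (\<lambda>(g, a). g @ [a]) ` Sigma (monic_polys R k) ?S"
    by (force simp: monic_polys_Suc)
  also have "card \<dots> = card (Sigma (monic_polys R k) ?S)"
    by (rule card_image) (auto simp: inj_on_def)
  also have "\<dots> = (\<Sum>g\<in>monic_polys R k. card (?S g))"
    using fin by (intro card_SigmaI finite_monic_polys) auto
  also have "\<dots> = (\<Sum>g\<in>monic_polys R k. card {a \<in> carrier R. a \<otimes> (\<alpha> \<ominus> \<beta>) = \<zero>})"
  proof (rule sum.cong[OF refl])
    fix g assume "g \<in> monic_polys R k"
    note gs = set_monic_polys[OF this]
    \<comment> \<open>Two appended zeros multiply \<open>g\<close> by \<open>x\<close> twice, so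
      \<open>?h\<close> is the part of degree at least two.\<close>
    let ?h = "(g @ [\<zero>]) @ [\<zero>]"
    note ev = eval_in_carrier[OF gs \<alpha>] eval_in_carrier[OF gs \<beta>]
    have "set ?h \<subseteq> carrier R" using gs by auto
    from eval_diff_divisible[OF this \<beta> \<alpha>] obtain c
      where c: "c \<in> carrier R" "eval ?h \<beta> \<ominus> eval ?h \<alpha> = c \<otimes> (\<beta> \<ominus> \<alpha>)" by auto
    have h: "eval ?h x = eval g x \<otimes> x \<otimes> x" if "x \<in> carrier R" for x
      using that gs eval_in_carrier[OF gs that] by (subst eval_append_aux) (auto simp: eval_append_aux)
    have "?S g = {a \<in> carrier R. a \<otimes> (\<alpha> \<ominus> \<beta>) = (\<ominus> c) \<otimes> (\<alpha> \<ominus> \<beta>)}"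
    proof (rule Collect_cong, rule conj_cong[OF refl])
      fix a assume a: "a \<in> carrier R"
      have "eval (g @ [a]) \<alpha> \<otimes> \<alpha> = eval (g @ [a]) \<beta> \<otimes> \<beta> \<longleftrightarrow>
         eval g \<alpha> \<otimes> \<alpha> \<otimes> \<alpha> \<oplus> a \<otimes> \<alpha> = eval g \<beta> \<otimes> \<beta> \<otimes> \<beta> \<oplus> a \<otimes> \<beta>"
        using a gs \<alpha> \<beta> ev by (simp add: eval_append_aux l_distr)
      also have "\<dots> \<longleftrightarrow> a \<otimes> (\<alpha> \<ominus> \<beta>) = eval g \<beta> \<otimes> \<beta> \<otimes> \<beta> \<ominus> eval g \<alpha> \<otimes> \<alpha> \<otimes> \<alpha>"
      proof
        assume eq: "eval g \<alpha> \<otimes> \<alpha> \<otimes> \<alpha> \<oplus> a \<otimes> \<alpha> = eval g \<beta> \<otimes> \<beta> \<otimes> \<beta> \<oplus> a \<otimes> \<beta>"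
        have "a \<otimes> (\<alpha> \<ominus> \<beta>) = (eval g \<alpha> \<otimes> \<alpha> \<otimes> \<alpha> \<oplus> a \<otimes> \<alpha>) \<ominus> eval g \<alpha> \<otimes> \<alpha> \<otimes> \<alpha> \<ominus> a \<otimes> \<beta>"
          using a \<alpha> \<beta> ev by algebra
        also have "\<dots> = eval g \<beta> \<otimes> \<beta> \<otimes> \<beta> \<ominus> eval g \<alpha> \<otimes> \<alpha> \<otimes> \<alpha>"
          unfolding eq using a \<alpha> \<beta> ev by algebra
        finally show "a \<otimes> (\<alpha> \<ominus> \<beta>) = eval g \<beta> \<otimes> \<beta> \<otimes> \<beta> \<ominus> eval g \<alpha> \<otimes> \<alpha> \<otimes> \<alpha>" .
      next
        assume eq: "a \<otimes> (\<alpha> \<ominus> \<beta>) = eval g \<beta> \<otimes> \<beta> \<otimes> \<beta> \<ominus> eval g \<alpha> \<otimes> \<alpha> \<otimes> \<alpha>"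
        have "eval g \<alpha> \<otimes> \<alpha> \<otimes> \<alpha> \<oplus> a \<otimes> \<alpha> = eval g \<alpha> \<otimes> \<alpha> \<otimes> \<alpha> \<oplus> (a \<otimes> (\<alpha> \<ominus> \<beta>) \<oplus> a \<otimes> \<beta>)"
          using a \<alpha> \<beta> ev by algebra
        also have "\<dots> = eval g \<beta> \<otimes> \<beta> \<otimes> \<beta> \<oplus> a \<otimes> \<beta>"
          unfolding eq using a \<alpha> \<beta> ev by algebra
        finally show "eval g \<alpha> \<otimes> \<alpha> \<otimes> \<alpha> \<oplus> a \<otimes> \<alpha> = eval g \<beta> \<otimes> \<beta> \<otimes> \<beta> \<oplus> a \<otimes> \<beta>" .
      qed
      also have "eval g \<beta> \<otimes> \<beta> \<otimes> \<beta> \<ominus> eval g \<alpha> \<otimes> \<alpha> \<otimes> \<alpha> = c \<otimes> (\<beta> \<ominus> \<alpha>)"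
        using c(2) h \<alpha> \<beta> by simp
      also have "\<dots> = (\<ominus> c) \<otimes> (\<alpha> \<ominus> \<beta>)" using c(1) \<alpha> \<beta> by algebra
      finally show "eval (g @ [a]) \<alpha> \<otimes> \<alpha> = eval (g @ [a]) \<beta> \<otimes> \<beta> \<longleftrightarrow>
        a \<otimes> (\<alpha> \<ominus> \<beta>) = (\<ominus> c) \<otimes> (\<alpha> \<ominus> \<beta>)" .
    qed
    then show "card (?S g) = card {a \<in> carrier R. a \<otimes> (\<alpha> \<ominus> \<beta>) = \<zero>}"
      using card_linear_solutions[of "\<ominus> c" "\<alpha> \<ominus> \<beta>"] c(1) \<alpha> \<beta> by simp
  qed
  finally show ?thesis by simp
qed

section \<open>Moments of the number of roots over a finite commutative ring\<close>

text \<open>Double counting of the pairs of a polynomial and one of its roots.\<close>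

lemma (in cring) sum_num_roots:
  assumes "finite (carrier R)"
  shows "(\<Sum>f\<in>monic_polys R (Suc k). num_roots R f) = card (carrier R) ^ Suc k"
proof -
  have "(\<Sum>f\<in>monic_polys R (Suc k). num_roots R f)
      = (\<Sum>\<alpha>\<in>carrier R. card {f \<in> monic_polys R (Suc k). eval f \<alpha> = \<zero>})"
    unfolding num_roots_def using assms
    by (intro sum_multicount_gen finite_monic_polys) auto
  also have "\<dots> = card (carrier R) ^ Suc k"
    using assms by (simp add: card_monic_polys_root card_monic_polys)
  finally show ?thesis .
qed

text \<open>The square counts ordered pairs of roots, equal ones included; double counting then
  reduces to the two-root count.\<close>

lemma (in cring) sum_num_roots_squared:
  assumes fin: "finite (carrier R)"
  shows "(\<Sum>f\<in>monic_polys R (Suc (Suc k)). (num_roots R f)\<^sup>2)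
    = card (carrier R) ^ Suc k * (\<Sum>\<delta>\<in>carrier R. card {a \<in> carrier R. a \<otimes> \<delta> = \<zero>})"
proof -
  let ?A = "\<lambda>\<delta>. card {a \<in> carrier R. a \<otimes> \<delta> = \<zero>}"
  let ?M = "monic_polys R (Suc (Suc k))"
  have sq: "(num_roots R f)\<^sup>2
      = card {x \<in> carrier R \<times> carrier R. eval f (fst x) = \<zero> \<and> eval f (snd x) = \<zero>}" for f
  proof -
    have "{x \<in> carrier R \<times> carrier R. eval f (fst x) = \<zero> \<and> eval f (snd x) = \<zero>}
      = {\<alpha> \<in> carrier R. eval f \<alpha> = \<zero>} \<times> {\<alpha> \<in> carrier R. eval f \<alpha> = \<zero>}" by auto
    then show ?thesis
      by (simp add: num_roots_def power2_eq_square card_cartesian_product)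
  qed
  have "(\<Sum>f\<in>?M. (num_roots R f)\<^sup>2)
    = (\<Sum>x\<in>carrier R \<times> carrier R. card {f \<in> ?M. eval f (fst x) = \<zero> \<and> eval f (snd x) = \<zero>})"
    unfolding sq using fin by (intro sum_multicount_gen finite_monic_polys) auto
  also have "\<dots> = (\<Sum>x\<in>carrier R \<times> carrier R. card (monic_polys R k) * ?A (fst x \<ominus> snd x))"
    using fin by (intro sum.cong refl card_monic_polys_two_roots) auto
  also have "\<dots> = (\<Sum>\<alpha>\<in>carrier R. \<Sum>\<beta>\<in>carrier R. card (monic_polys R k) * ?A (\<alpha> \<ominus> \<beta>))"
    by (simp add: sum.cartesian_product case_prod_unfold)
  also have "\<dots> = (\<Sum>\<alpha>\<in>carrier R. \<Sum>\<delta>\<in>carrier R. card (monic_polys R k) * ?A \<delta>)"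
  proof (rule sum.cong[OF refl])
    fix \<alpha> assume \<alpha>: "\<alpha> \<in> carrier R"
    have inv: "\<alpha> \<ominus> (\<alpha> \<ominus> \<beta>) = \<beta>" if "\<beta> \<in> carrier R" for \<beta>
      using that \<alpha> by algebra
    \<comment> \<open>This map is an involution, so the inner sum does not depend on \<alpha>.
      Summing over \<alpha> raises the exponent from \<open>k\<close> to
      \<open>Suc k\<close>.\<close>
    have "bij_betw (\<lambda>\<beta>. \<alpha> \<ominus> \<beta>) (carrier R) (carrier R)"
      using \<alpha> inv by (intro bij_betw_byWitness[where f' = "\<lambda>\<beta>. \<alpha> \<ominus> \<beta>"]) auto
    then show "(\<Sum>\<beta>\<in>carrier R. card (monic_polys R k) * ?A (\<alpha> \<ominus> \<beta>))
      = (\<Sum>\<delta>\<in>carrier R. card (monic_polys R k) * ?A \<delta>)"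
      by (rule sum.reindex_bij_betw)
  qed
  also have "\<dots> = card (carrier R) ^ Suc k * (\<Sum>\<delta>\<in>carrier R. ?A \<delta>)"
    by (simp add: sum_distrib_left[symmetric] card_monic_polys[OF fin] mult.assoc)
  finally show ?thesis .
qed

lemma (in cring) num_roots_linear:
  assumes "f \<in> monic_polys R 1"
  shows "num_roots R f = 1"
proof -
  obtain b where b: "f = [\<one>, b]" "b \<in> carrier R"
    using assms by (auto simp: monic_polys_def length_Suc_conv)
  have "{\<alpha> \<in> carrier R. eval f \<alpha> = \<zero>} = {\<ominus> b}"
    using b by (auto simp: minus_equality[symmetric] l_neg intro: minus_equality)
  then show ?thesis by (simp add: num_roots_def)
qed

section \<open>Annihilators in the integers modulo n\<close>

text \<open>After division by \<open>g = gcd d n\<close> the cofactor of \<open>d\<close> is coprime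
  to \<open>n' = n / g\<close>, so the solutions are the \<open>g\<close> multiples of
  \<open>n'\<close> up to \<open>n\<close>. The representatives 1 to \<open>n\<close> match the
  range used in counting by gcd.\<close>

lemma card_annihilator_gcd:
  fixes n d :: nat
  assumes "n > 0"
  shows "card {a \<in> {0<..n}. n dvd a * d} = gcd d n"
proof -
  define g where "g = gcd d n"
  obtain n' d' where nd: "n = n' * g" "d = d' * g" "coprime d' n'"
    using gcd_coprime_exists[of d n] assms unfolding g_def by auto
  have pos: "g > 0" "n' > 0" using assms nd by (auto intro: Nat.gr0I)
  have "n dvd a * d \<longleftrightarrow> n' dvd a" for a
    using nd pos by (simp add: coprime_dvd_mult_left_iff coprime_commute flip: mult.assoc)
  then have "{a \<in> {0<..n}. n dvd a * d} = {a \<in> {0<..n}. n' dvd a}" by simp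
  also have "\<dots> = (\<lambda>i. n' * i) ` {0<..g}"
    using nd(1) pos by (auto simp: dvd_def)
  also have "card \<dots> = g"
    using pos by (subst card_image) (auto simp: inj_on_def)
  finally show ?thesis by (simp add: g_def)
qed

text \<open>Group the \<open>k\<close> by their gcd with \<open>n\<close>: exactly
  \<open>totient (n div d)\<close> of them have gcd \<open>d\<close>.\<close>

lemma sum_gcd_eq_sum_totient:
  fixes n :: nat
  assumes "n > 0"
  shows "(\<Sum>k\<in>{0<..n}. gcd k n) = (\<Sum>d | d dvd n. d * totient (n div d))"
proof -
  have "(\<Sum>k\<in>{0<..n}. gcd k n)
      = (\<Sum>d | d dvd n. \<Sum>k\<in>{k \<in> {0<..n}. gcd k n = d}. gcd k n)"
    using assms by (subst sum.group) auto
  also have "\<dots> = (\<Sum>d | d dvd n. d * totient (n div d))"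
    using assms by (intro sum.cong refl) (simp add: card_gcd_eq_totient[symmetric] mult.commute)
  finally show ?thesis .
qed

lemma bij_betw_ZMod:
  assumes "n > 0"
  shows "bij_betw (\<lambda>k. ZMod (int n) (int k)) {0<..n} (carrier (ZFact (int n)))"
proof -
  let ?z = "\<lambda>k. ZMod (int n) (int k)"
  have inj: "inj_on ?z {0<..n}"
  proof (rule inj_onI)
    fix x y assume xy: "x \<in> {0<..n}" "y \<in> {0<..n}" and "?z x = ?z y"
    then have "x mod n = y mod n" by (simp add: ZMod_eq_mod flip: zmod_int)
    \<comment> \<open>The representative \<open>n\<close> has residue 0, while every smaller one is
      its own nonzero residue.\<close>
    then show "x = y" using xy by (cases "x = n"; cases "y = n") auto
  qed
  have "?z ` {0<..n} \<subseteq> carrier (ZFact (int n))"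
    by (auto simp: ZMod_def ZFact_defs int.a_rcosetsI)
  \<comment> \<open>Surjectivity follows from equal finite cardinalities.\<close>
  then have "?z ` {0<..n} = carrier (ZFact (int n))"
    using assms by (intro card_subset_eq) (simp_all add: finite_ZFact card_ZFact card_image[OF inj])
  with inj show ?thesis by (simp add: bij_betw_def)
qed

text \<open>The residue map is a ring homomorphism, which turns annihilators in the quotient into
  divisibility of integers.\<close>

lemma ZMod_mult_eq_zero_iff:
  "ZMod k a \<otimes>\<^bsub>ZFact k\<^esub> ZMod k b = \<zero>\<^bsub>ZFact k\<^esub> \<longleftrightarrow> k dvd a * b"
proof -
  interpret ideal "Idl\<^bsub>\<Z>\<^esub> {k}" \<Z> by (rule int.genideal_ideal) simp
  interpret h: ring_hom_ring \<Z> "ZFact k" "(+>\<^bsub>\<Z>\<^esub>) (Idl\<^bsub>\<Z>\<^esub> {k})"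
    unfolding ZFact_def by (rule rcos_ring_hom_ring)
  have "ZMod k a \<otimes>\<^bsub>ZFact k\<^esub> ZMod k b = ZMod k (a * b)"
    using h.hom_mult[of a b] by (simp add: ZMod_def)
  moreover have "\<zero>\<^bsub>ZFact k\<^esub> = ZMod k 0"
    using h.hom_zero by (simp add: ZMod_def)
  ultimately show ?thesis by (simp add: ZMod_eq_mod dvd_eq_mod_eq_0)
qed

lemma sum_card_annihilator_ZFact:
  assumes "n > 0"
  shows "(\<Sum>\<delta>\<in>carrier (ZFact (int n)).
      card {a \<in> carrier (ZFact (int n)). a \<otimes>\<^bsub>ZFact (int n)\<^esub> \<delta> = \<zero>\<^bsub>ZFact (int n)\<^esub>})
    = (\<Sum>d | d dvd n. d * totient (n div d))"
proof -
  let ?R = "ZFact (int n)" and ?z = "\<lambda>k. ZMod (int n) (int k)"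
  note bij = bij_betw_ZMod[OF assms]
  have card: "card {a \<in> carrier ?R. a \<otimes>\<^bsub>?R\<^esub> ?z d = \<zero>\<^bsub>?R\<^esub>} = gcd d n" for d
  proof -
    have "{a \<in> carrier ?R. a \<otimes>\<^bsub>?R\<^esub> ?z d = \<zero>\<^bsub>?R\<^esub>}
        = ?z ` {a \<in> {0<..n}. ?z a \<otimes>\<^bsub>?R\<^esub> ?z d = \<zero>\<^bsub>?R\<^esub>}"
      unfolding bij_betw_imp_surj_on[OF bij, symmetric] by blast
    also have "\<dots> = ?z ` {a \<in> {0<..n}. n dvd a * d}"
      by (simp add: ZMod_mult_eq_zero_iff flip: of_nat_mult)
    also have "card \<dots> = card {a \<in> {0<..n}. n dvd a * d}"
      using bij by (intro card_image inj_on_subset[OF bij_betw_imp_inj_on[OF bij]]) auto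
    also have "\<dots> = gcd d n" by (rule card_annihilator_gcd[OF assms])
    finally show ?thesis .
  qed
  show ?thesis
    by (subst sum.reindex_bij_betw[OF bij, symmetric])
      (simp add: card sum_gcd_eq_sum_totient[OF assms])
qed

section \<open>Divisor sums\<close>

text \<open>The map sending \<open>d\<close> to \<open>n div d\<close> permutes the divisors, which
  reduces this to Gauss's identity for the totient.\<close>

lemma totient_div_sum:
  fixes n :: nat
  assumes "n > 0"
  shows "(\<Sum>d | d dvd n. totient (n div d)) = n"
proof -
  have "bij_betw (\<lambda>d. n div d) {d. d dvd n} {d. d dvd n}"
    using assms by (intro bij_betw_byWitness[where f' = "\<lambda>d. n div d"]) auto
  then have "(\<Sum>d | d dvd n. totient (n div d)) = (\<Sum>d | d dvd n. totient d)"
    by (rule sum.reindex_bij_betw)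
  then show ?thesis by (simp add: totient_divisor_sum)
qed

text \<open>The omitted divisor \<open>d = n\<close> would contribute exactly 1. The right-hand side
  is the form in which the variance arises, second moment minus squared mean.\<close>

lemma sum_proper_divisors_totient:
  assumes "n > 0"
  shows "(\<Sum>d | d dvd n \<and> d \<noteq> n. real d / real n * real (totient (n div d)))
    = real (\<Sum>d | d dvd n. d * totient (n div d)) / real n - 1"
proof -
  have "{d. d dvd n} = insert n {d. d dvd n \<and> d \<noteq> n}" "finite {d. d dvd n \<and> d \<noteq> n}"
    using assms by auto
  then have "(\<Sum>d | d dvd n. real d / real n * real (totient (n div d)))
    = (\<Sum>d | d dvd n \<and> d \<noteq> n. real d / real n * real (totient (n div d))) + 1"
    using assms by simp
  then show ?thesis by (simp add: sum_divide_distrib)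
qed

lemma sum_divisors_totient:
  assumes "n > 0"
  shows "(\<Sum>d | d dvd n. (real d - 1) / real n * real (totient (n div d)))
    = real (\<Sum>d | d dvd n. d * totient (n div d)) / real n - 1"
proof -
  have "(\<Sum>d | d dvd n. (real d - 1) / real n * real (totient (n div d)))
    = real (\<Sum>d | d dvd n. d * totient (n div d)) / real n
      - real (\<Sum>d | d dvd n. totient (n div d)) / real n"
    by (simp add: sum_divide_distrib sum_subtractf diff_divide_distrib left_diff_distrib)
  with assms show ?thesis by (simp only: totient_div_sum) simp
qed

text \<open>The proper divisors are \<open>p ^ i\<close> with \<open>i < k\<close>, and each
  contributes the same amount \<open>1 - 1 / p\<close>.\<close>

lemma sum_proper_divisors_totient_prime_power:
  fixes p k :: nat
  assumes p: "Factorial_Ring.prime p"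
  shows "(\<Sum>d | d dvd p ^ k \<and> d \<noteq> p ^ k. real d / real (p ^ k) * real (totient (p ^ k div d)))
    = real k * (1 - 1 / real p)"
proof -
  have p1: "p > 1" using p by (rule prime_gt_1_nat)
  have set: "{d. d dvd p ^ k \<and> d \<noteq> p ^ k} = (\<lambda>i. p ^ i) ` {..<k}"
    using p1 by (auto simp: divides_primepow_nat[OF p] le_less image_iff)
  have "(\<Sum>d | d dvd p ^ k \<and> d \<noteq> p ^ k. real d / real (p ^ k) * real (totient (p ^ k div d)))
    = (\<Sum>i<k. real (p ^ i) / real (p ^ k) * real (totient (p ^ k div p ^ i)))"
    unfolding set using p1 by (subst sum.reindex) (auto simp: inj_on_def)
  also have "\<dots> = (\<Sum>i<k. 1 - 1 / real p)"
  proof (rule sum.cong[OF refl])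
    fix i assume "i \<in> {..<k}"
    \<comment> \<open>As \<open>i < k\<close>, the exponent \<open>k - i\<close> is a successor, so
      the totient formula for positive prime powers applies.\<close>
    then obtain j where k: "k = i + Suc j" by (auto simp: less_iff_Suc_add)
    have "p ^ k div p ^ i = p ^ Suc j" using p1 by (simp add: k power_add)
    then show "real (p ^ i) / real (p ^ k) * real (totient (p ^ k div p ^ i)) = 1 - 1 / real p"
      using p1 by (simp only: totient_prime_power_Suc[OF p]) (simp add: k power_add field_simps of_nat_diff)
  qed
  finally show ?thesis by simp
qed

section \<open>Expectation and variance\<close>

text \<open>Stated for natural-valued \<open>h\<close> so that it links the counting identities to
  both moments, with \<open>h\<close> the number of roots or its square.\<close>

lemma expectation_random_monic:
  fixes h :: "int set list \<Rightarrow> nat"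
  assumes "n > 0"
  shows "measure_pmf.expectation (random_monic n m) (\<lambda>f. real (h f))
    = real (\<Sum>f\<in>monic_polys (ZFact (int n)) m. h f) / real (n ^ m)"
proof -
  let ?M = "monic_polys (ZFact (int n)) m"
  have fin: "finite ?M" and card: "card ?M = n ^ m"
    using assms by (simp_all add: finite_monic_polys finite_ZFact card_monic_polys card_ZFact)
  moreover have "?M \<noteq> {}" using card assms by auto
  ultimately show ?thesis by (simp add: random_monic_def integral_pmf_of_set)
qed

theorem theorem1:
  fixes n m :: nat and N :: "int set list \<Rightarrow> real"
  assumes "n \<ge> 1" and "m > 0"
  defines "N \<equiv> \<lambda>f. real (num_roots (ZFact (int n)) f)"
  shows "measure_pmf.expectation (random_monic n m) N = 1
    \<and> (m = 1 \<longrightarrow> measure_pmf.variance (random_monic n m) N = 0)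
    \<and> (m \<noteq> 1 \<longrightarrow>
         measure_pmf.variance (random_monic n m) N
           = (\<Sum>d | d dvd n \<and> d \<noteq> n. real d / real n * real (totient (n div d)))
       \<and> (\<Sum>d | d dvd n \<and> d \<noteq> n. real d / real n * real (totient (n div d)))
           = (\<Sum>d | d dvd n. (real d - 1) / real n * real (totient (n div d))))
    \<and> (\<forall>p k :: nat. m > 1 \<and> Factorial_Ring.prime p \<and> k \<ge> 1 \<and> n = p ^ k \<longrightarrow>
         measure_pmf.variance (random_monic n m) N = real k * (1 - 1 / real p))"
proof -
  let ?R = "ZFact (int n)"
  interpret R: cring ?R by (rule ZFact_is_cring)
  have n: "n > 0" using assms(1) by simp
  have fin: "finite (carrier ?R)" and card: "card (carrier ?R) = n"
    using assms(1) by (simp_all add: finite_ZFact card_ZFact)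
  have E1: "measure_pmf.expectation (random_monic n m) N = 1"
  proof -
    obtain k where "m = Suc k" using assms(2) by (cases m) auto
    then show ?thesis
      using n by (simp add: N_def expectation_random_monic R.sum_num_roots[OF fin] card
        del: of_nat_sum power_Suc)
  qed
  have "finite (set_pmf (random_monic n m))"
    using assms(1) fin by (simp add: set_pmf_random_monic finite_monic_polys)
  then have var: "measure_pmf.variance (random_monic n m) N
      = measure_pmf.expectation (random_monic n m) (\<lambda>f. (N f)\<^sup>2) - 1"
    by (subst measure_pmf.variance_eq) (simp_all add: integrable_measure_pmf_finite E1)
  have E2: "measure_pmf.expectation (random_monic n m) (\<lambda>f. (N f)\<^sup>2)
      = real (\<Sum>f\<in>monic_polys ?R m. (num_roots ?R f)\<^sup>2) / real (n ^ m)"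
    using expectation_random_monic[OF n, of m "\<lambda>f. (num_roots ?R f)\<^sup>2"] by (simp add: N_def)
  have var1: "measure_pmf.variance (random_monic n m) N = 0" if "m = 1"
  proof -
    have "(\<Sum>f\<in>monic_polys ?R m. (num_roots ?R f)\<^sup>2) = n"
      using R.num_roots_linear that by (simp add: card_monic_polys[OF fin] card)
    then show ?thesis unfolding var E2 using n that by simp
  qed
  have var2: "measure_pmf.variance (random_monic n m) N
      = (\<Sum>d | d dvd n \<and> d \<noteq> n. real d / real n * real (totient (n div d)))" if "m \<noteq> 1"
  proof -
    \<comment> \<open>Degree at least two makes the linear coefficient distinct from the leading
      one, as the two-root count requires.\<close>
    obtain k where m: "m = Suc (Suc k)"
      using assms(2) \<open>m \<noteq> 1\<close> by (cases m rule: nat.exhaust; cases "m - 1") auto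
    have "(\<Sum>f\<in>monic_polys ?R m. (num_roots ?R f)\<^sup>2)
        = n ^ Suc k * (\<Sum>d | d dvd n. d * totient (n div d))"
      by (simp only: m R.sum_num_roots_squared[OF fin] card sum_card_annihilator_ZFact[OF n])
    \<comment> \<open>The quotient of \<open>n ^ Suc k\<close> by \<open>n ^ m\<close> leaves the
      factor \<open>1 / n\<close> in front of the divisor sum.\<close>
    then show ?thesis
      unfolding var E2 sum_proper_divisors_totient[OF n] using n by (simp add: m del: of_nat_sum)
  qed
  show ?thesis
    using E1 var1 var2 sum_proper_divisors_totient[OF n] sum_divisors_totient[OF n]
      sum_proper_divisors_totient_prime_power by auto
qed

end
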